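(* Let $R$ be a commutative, associative, unital ring and let $N$ be an $R$-module. If $N$ is $\text{Red}(N)$-lifting, then any $R$-module $K$ is $\text{Red}$-$N$-injective if and only if $K$ is $N$-injective.
   Context: All modules are unital right $R$-modules. An $R$-module $M$ is reduced if for all $r\in R$ and $m\in M$, $mr^{2}=0$ implies $mr=0$; a submodule is reduced if it is reduced as a module. $\text{Red}(M)$ denotes the sum of all reduced submodules of $M$. A module $M$ is semi-reduced if $\text{Red}(M)=M$; a submodule is semi-reduced if it is so as a module. For $R$-modules $M$ and $N$, $M$ is $\text{Red}$-$N$-injective if for every semi-reduced submodule $K$ of $N$, every $R$-homomorphism $f:K\rightarrow M$ extends to an $R$-homomorphism $N\rightarrow M$; $M$ is $N$-injective if every $R$-homomorphism from a submodule of $N$ into $M$ extends to $N$. For a submodule $X$ of a module $M$, $\text{Red}(M)$ respects $X$ if there exists a direct summand $A$ of $M$ contained in $X$ such that $X=A\oplus B$ for some submodule $B\leq \text{Red}(M)$. $M$ is called $\text{Red}(M)$-lifting if $\text{Red}(M)$ respects every submodule of $M$. *)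

theory Defs
  imports "HOL-Algebra.Module" "HOL-Algebra.AbelCoset"
begin

text \<open>
  The locale \<^locale>\<open>module\<close> has a commutative coefficient ring, so its scalar action
  \<open>r \<odot> m\<close> serves equally as the right action \<open>m r\<close>.
  A submodule \<open>H\<close> of \<open>M\<close>, viewed as a module in its own right, is
  \<open>M\<lparr>carrier := H\<rparr>\<close>.
\<close>

definition rmodule_hom ::
  "('r, 'x) ring_scheme \<Rightarrow> ('r, 'a, 'y) module_scheme \<Rightarrow> ('r, 'b, 'z) module_scheme \<Rightarrow> ('a \<Rightarrow> 'b) set"
  where "rmodule_hom R M N =
    {f \<in> hom (add_monoid M) (add_monoid N).
       \<forall>r \<in> carrier R. \<forall>m \<in> carrier M. f (r \<odot>\<^bsub>M\<^esub> m) = r \<odot>\<^bsub>N\<^esub> f m}"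

definition reduced_module :: "('r, 'x) ring_scheme \<Rightarrow> ('r, 'a, 'y) module_scheme \<Rightarrow> bool"
  where "reduced_module R M \<longleftrightarrow>
    (\<forall>r \<in> carrier R. \<forall>m \<in> carrier M.
       (r [^]\<^bsub>R\<^esub> (2::nat)) \<odot>\<^bsub>M\<^esub> m = \<zero>\<^bsub>M\<^esub> \<longrightarrow> r \<odot>\<^bsub>M\<^esub> m = \<zero>\<^bsub>M\<^esub>)"

definition reduced_submodules :: "('r, 'x) ring_scheme \<Rightarrow> ('r, 'a, 'y) module_scheme \<Rightarrow> 'a set set"
  where "reduced_submodules R M =
    {H. submodule H R M \<and> reduced_module R (M\<lparr>carrier := H\<rparr>)}"

text \<open>
  The sum of a family of submodules: all finite sums of elements \<open>x H \<in> H\<close>, for \<open>H\<close> in the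
  family.
\<close>

definition Red :: "('r, 'x) ring_scheme \<Rightarrow> ('r, 'a, 'y) module_scheme \<Rightarrow> 'a set"
  where "Red R M =
    {\<Oplus>\<^bsub>M\<^esub>H \<in> F. x H | F x. finite F \<and> F \<subseteq> reduced_submodules R M \<and> (\<forall>H \<in> F. x H \<in> H)}"

definition semi_reduced :: "('r, 'x) ring_scheme \<Rightarrow> ('r, 'a, 'y) module_scheme \<Rightarrow> bool"
  where "semi_reduced R M \<longleftrightarrow> Red R M = carrier M"

definition rel_injective ::
  "('r, 'x) ring_scheme \<Rightarrow> ('r, 'a, 'y) module_scheme \<Rightarrow> ('r, 'b, 'z) module_scheme \<Rightarrow> bool"
  where "rel_injective R M N \<longleftrightarrow>
    (\<forall>L f. submodule L R N \<and> f \<in> rmodule_hom R (N\<lparr>carrier := L\<rparr>) M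
       \<longrightarrow> (\<exists>g \<in> rmodule_hom R N M. \<forall>x \<in> L. g x = f x))"

definition Red_rel_injective ::
  "('r, 'x) ring_scheme \<Rightarrow> ('r, 'a, 'y) module_scheme \<Rightarrow> ('r, 'b, 'z) module_scheme \<Rightarrow> bool"
  where "Red_rel_injective R M N \<longleftrightarrow>
    (\<forall>L f. submodule L R N \<and> semi_reduced R (N\<lparr>carrier := L\<rparr>)
         \<and> f \<in> rmodule_hom R (N\<lparr>carrier := L\<rparr>) M
       \<longrightarrow> (\<exists>g \<in> rmodule_hom R N M. \<forall>x \<in> L. g x = f x))"

definition is_direct_sum ::
  "('r, 'x) ring_scheme \<Rightarrow> ('r, 'a, 'y) module_scheme \<Rightarrow> 'a set \<Rightarrow> 'a set \<Rightarrow> 'a set \<Rightarrow> bool"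
  where "is_direct_sum R M X A B \<longleftrightarrow>
    submodule A R M \<and> submodule B R M \<and> X = A <+>\<^bsub>M\<^esub> B \<and> A \<inter> B = {\<zero>\<^bsub>M\<^esub>}"

definition direct_summand ::
  "('r, 'x) ring_scheme \<Rightarrow> ('r, 'a, 'y) module_scheme \<Rightarrow> 'a set \<Rightarrow> bool"
  where "direct_summand R M A \<longleftrightarrow> (\<exists>A'. is_direct_sum R M (carrier M) A A')"

definition Red_respects ::
  "('r, 'x) ring_scheme \<Rightarrow> ('r, 'a, 'y) module_scheme \<Rightarrow> 'a set \<Rightarrow> bool"
  where "Red_respects R M X \<longleftrightarrow>
    (\<exists>A B. direct_summand R M A \<and> A \<subseteq> X \<and> B \<subseteq> Red R M \<and> is_direct_sum R M X A B)"

definition Red_lifting :: "('r, 'x) ring_scheme \<Rightarrow> ('r, 'a, 'y) module_scheme \<Rightarrow> bool"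
  where "Red_lifting R M \<longleftrightarrow> (\<forall>X. submodule X R M \<longrightarrow> Red_respects R M X)"

end

theory Submission
  imports Defs
begin

text \<open>
  A submodule of \<open>Red N\<close> need not be semi-reduced, so the restriction of a homomorphism
  \<open>f : L \<rightarrow> K\<close> to the part \<open>B\<close> of a decomposition \<open>L = A \<oplus> B\<close>
  cannot be extended directly. Instead take \<open>f\<close> with a maximal domain \<open>L\<close> (Zorn); it suffices to
  find, for each \<open>n\<close> in \<open>N\<close>, some \<open>k\<close> in \<open>K\<close> with \<open>f (r n) = r k\<close> whenever \<open>r n\<close> lies in
  \<open>L\<close>, as in Baer's criterion.

  If \<open>n\<close> lies in a reduced submodule \<open>H\<close>, then \<open>L \<inter> H\<close> is reduced; hence \<open>f\<close> extends from there to
  some \<open>g\<close> on \<open>N\<close>, and \<open>k = g n\<close> works. So \<open>L\<close> contains the semi-reduced module \<open>Red N\<close>, and there is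
  \<open>h\<close> on \<open>N\<close> which agrees with \<open>f\<close> on \<open>Red N\<close>. For arbitrary \<open>n\<close> decompose
  \<open>L \<inter> R n = A \<oplus> B\<close> with \<open>N = A \<oplus> A'\<close> and \<open>B \<subseteq> Red N\<close>, and let \<open>a\<close> be the component of \<open>n\<close> in
  \<open>A\<close>. Then \<open>k = f a - h a + h n\<close> works, because \<open>f - h\<close> vanishes on \<open>B\<close>.
\<close>

section \<open>Submodules and reduced modules\<close>

lemma (in module) submodule_zero:
  assumes "submodule H R M"
  shows "\<zero>\<^bsub>M\<^esub> \<in> H"
  using subgroup.one_closed[OF submodule.axioms(1)[OF assms]] by simp

text \<open>Closure under negation follows from closure under scalars, since -a = (-1) a.\<close>

lemma (in module) submoduleI':
  assumes "H \<subseteq> carrier M" "\<zero>\<^bsub>M\<^esub> \<in> H"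
    and "\<And>a b. a \<in> H \<Longrightarrow> b \<in> H \<Longrightarrow> a \<oplus>\<^bsub>M\<^esub> b \<in> H"
    and smult: "\<And>a x. a \<in> carrier R \<Longrightarrow> x \<in> H \<Longrightarrow> a \<odot>\<^bsub>M\<^esub> x \<in> H"
  shows "submodule H R M"
proof (rule submoduleI)
  fix a assume a: "a \<in> H"
  then have "\<ominus>\<^bsub>M\<^esub> a = (\<ominus>\<^bsub>R\<^esub> \<one>\<^bsub>R\<^esub>) \<odot>\<^bsub>M\<^esub> a"
    using assms(1) by (auto simp: smult_l_minus)
  then show "\<ominus>\<^bsub>M\<^esub> a \<in> H" using smult a by simp
qed (use assms in auto)

lemma (in module) submodule_Int:
  assumes "submodule H R M" "submodule L R M"
  shows "submodule (H \<inter> L) R M"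
  using submoduleE[OF assms(1)] submoduleE[OF assms(2)] assms[THEN submodule_zero]
  by (intro submoduleI') auto

lemma (in module) submodule_cyclic:
  assumes "n \<in> carrier M"
  shows "submodule {r \<odot>\<^bsub>M\<^esub> n | r. r \<in> carrier R} R M"
proof (rule submoduleI')
  show "\<zero>\<^bsub>M\<^esub> \<in> {r \<odot>\<^bsub>M\<^esub> n | r. r \<in> carrier R}"
    using assms by (auto intro!: exI[of _ "\<zero>\<^bsub>R\<^esub>"])
next
  fix a b
  assume "a \<in> {r \<odot>\<^bsub>M\<^esub> n | r. r \<in> carrier R}" "b \<in> {r \<odot>\<^bsub>M\<^esub> n | r. r \<in> carrier R}"
  then show "a \<oplus>\<^bsub>M\<^esub> b \<in> {r \<odot>\<^bsub>M\<^esub> n | r. r \<in> carrier R}"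
    using assms smult_l_distr R.add.m_closed by (smt (verit) mem_Collect_eq)
next
  fix a x
  assume "a \<in> carrier R" "x \<in> {r \<odot>\<^bsub>M\<^esub> n | r. r \<in> carrier R}"
  then show "a \<odot>\<^bsub>M\<^esub> x \<in> {r \<odot>\<^bsub>M\<^esub> n | r. r \<in> carrier R}"
    using assms smult_assoc1 R.m_closed by (smt (verit) mem_Collect_eq)
qed (use assms in auto)

text \<open>The conditions of \<open>submoduleI'\<close> use only operations stored in the record,
  which a change of carrier leaves alone. Negation, whose definition refers to the carrier, is
  avoided.\<close>

lemma (in module) submodule_in_submodule:
  assumes "submodule L R M" "H \<subseteq> L"
  shows "submodule H R (M\<lparr>carrier := L\<rparr>) \<longleftrightarrow> submodule H R M"
proof -
  interpret L: module R "M\<lparr>carrier := L\<rparr>"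
    using submodule.submodule_is_module[OF assms(1)] module_axioms by blast
  have "submodule H R M" if "submodule H R (M\<lparr>carrier := L\<rparr>)"
    using L.submoduleE[OF that] L.submodule_zero[OF that] submoduleE(1)[OF assms(1)] assms(2)
    by (intro submoduleI') auto
  moreover have "submodule H R (M\<lparr>carrier := L\<rparr>)" if "submodule H R M"
    using submoduleE[OF that] submodule_zero[OF that] assms(2)
    by (intro L.submoduleI') auto
  ultimately show ?thesis by blast
qed

text \<open>\<open>finsum\<close> is defined by a fold over the carrier, so the two sums do not
  agree by mere unfolding. The induction proves equality and membership together.\<close>

lemma (in module) finsum_submodule:
  assumes "submodule L R M" "finite F" "x \<in> F \<rightarrow> L"
  shows "finsum (M\<lparr>carrier := L\<rparr>) x F = finsum M x F" "finsum M x F \<in> L"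
proof -
  interpret L: module R "M\<lparr>carrier := L\<rparr>"
    using submodule.submodule_is_module[OF assms(1)] module_axioms by blast
  have "finsum (M\<lparr>carrier := L\<rparr>) x F = finsum M x F \<and> finsum M x F \<in> L"
    using assms(2,3)
  proof (induct F)
    case empty
    then show ?case using submodule_zero[OF assms(1)] by simp
  next
    case (insert a F)
    then have "x \<in> F \<rightarrow> carrier M" "x a \<in> carrier M" "x \<in> F \<rightarrow> L" "x a \<in> L"
      using submoduleE(1)[OF assms(1)] by auto
    then show ?case
      using insert submoduleE(5)[OF assms(1)] by simp
  qed
  then show "finsum (M\<lparr>carrier := L\<rparr>) x F = finsum M x F" "finsum M x F \<in> L" by auto
qed

section \<open>Reduced modules and the submodule \<open>Red\<close>\<close>

lemma reduced_submodule_mono: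
  assumes "reduced_module R (M\<lparr>carrier := H\<rparr>)" "L \<subseteq> H"
  shows "reduced_module R (M\<lparr>carrier := L\<rparr>)"
  using assms by (auto simp: reduced_module_def)

lemma (in module) reduced_submodule_le_Red:
  assumes "H \<in> reduced_submodules R M"
  shows "H \<subseteq> Red R M"
proof
  fix y assume y: "y \<in> H"
  then have "y \<in> carrier M"
    using assms submoduleE(1) by (auto simp: reduced_submodules_def)
  then have "y = finsum M (\<lambda>_. y) {H}" by simp
  then show "y \<in> Red R M"
    using assms y unfolding Red_def by (intro CollectI exI[of _ "{H}"] exI[of _ "\<lambda>_. y"]) auto
qed

text \<open>The whole carrier is itself one of the reduced submodules being summed.\<close>

lemma (in module) reduced_imp_semi_reduced:
  assumes "reduced_module R M"
  shows "semi_reduced R M"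
proof -
  have "M\<lparr>carrier := carrier M\<rparr> = M" by simp
  then have "carrier M \<in> reduced_submodules R M"
    using assms carrier_is_submodule by (simp add: reduced_submodules_def)
  then have "carrier M \<subseteq> Red R M" by (rule reduced_submodule_le_Red)
  moreover have "Red R M \<subseteq> carrier M"
    using submoduleE(1) by (auto simp: Red_def reduced_submodules_def Pi_def subset_eq intro!: finsum_closed)
  ultimately show ?thesis by (auto simp: semi_reduced_def)
qed

text \<open>With \<open>reduced_submodule_le_Red\<close> and \<open>submodule_Red\<close> this makes
  \<open>Red R M\<close> the least submodule containing all reduced ones. Once these are available,
  the finite sums need no more unfolding.\<close>

lemma (in module) Red_le_submodule:
  assumes "submodule L R M" "\<And>H. H \<in> reduced_submodules R M \<Longrightarrow> H \<subseteq> L"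
  shows "Red R M \<subseteq> L"
proof
  fix y assume "y \<in> Red R M"
  then obtain F x where F: "finite F" "F \<subseteq> reduced_submodules R M" "\<forall>H\<in>F. x H \<in> H"
    and y: "y = finsum M x F"
    by (auto simp: Red_def)
  then have "x \<in> F \<rightarrow> L" using assms(2) by blast
  then show "y \<in> L" using finsum_submodule(2)[OF assms(1)] F(1) y by blast
qed

lemma (in module) submodule_Red: "submodule (Red R M) R M"
proof (rule submoduleI')
  show "Red R M \<subseteq> carrier M"
    by (rule Red_le_submodule[OF carrier_is_submodule])
      (auto simp: reduced_submodules_def dest: submoduleE(1))
  show "\<zero>\<^bsub>M\<^esub> \<in> Red R M"
    unfolding Red_def by (intro CollectI exI[of _ "{}"]) auto
next
  fix a b assume "a \<in> Red R M" "b \<in> Red R M"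
  then obtain F x F' x' where
    F: "finite F" "F \<subseteq> reduced_submodules R M" "\<forall>H\<in>F. x H \<in> H" "a = finsum M x F"
    and F': "finite F'" "F' \<subseteq> reduced_submodules R M" "\<forall>H\<in>F'. x' H \<in> H" "b = finsum M x' F'"
    by (auto simp: Red_def)
  have sub: "submodule H R M" if "H \<in> F \<union> F'" for H
    using that F F' by (auto simp: reduced_submodules_def)
  \<comment> \<open>Padding with zeros puts both sums on the common index set
    \<open>F \<union> F'\<close>, where they can be added termwise.\<close>
  define u where "u H = (if H \<in> F then x H else \<zero>\<^bsub>M\<^esub>)" for H
  define u' where "u' H = (if H \<in> F' then x' H else \<zero>\<^bsub>M\<^esub>)" for H
  have u: "u H \<in> H" "u' H \<in> H" if "H \<in> F \<union> F'" for H
    using F(3) F'(3) submodule_zero[OF sub[OF that]] by (auto simp: u_def u'_def)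
  have uM: "u \<in> F \<union> F' \<rightarrow> carrier M" "u' \<in> F \<union> F' \<rightarrow> carrier M"
    using u sub submoduleE(1) by blast+
  have "a = finsum M u (F \<union> F')" "b = finsum M u' (F \<union> F')"
    unfolding F(4) F'(4)
    using F F' uM by (intro M.add.finprod_mono_neutral_cong_left; auto simp: u_def u'_def Pi_iff)+
  then have "a \<oplus>\<^bsub>M\<^esub> b = finsum M (\<lambda>H. u H \<oplus>\<^bsub>M\<^esub> u' H) (F \<union> F')"
    using uM by (simp add: finsum_addf)
  moreover have "u H \<oplus>\<^bsub>M\<^esub> u' H \<in> H" if "H \<in> F \<union> F'" for H
    using submoduleE(5)[OF sub[OF that]] u[OF that] by blast
  ultimately show "a \<oplus>\<^bsub>M\<^esub> b \<in> Red R M"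
    unfolding Red_def using F F'
    by (intro CollectI exI[of _ "F \<union> F'"] exI[of _ "\<lambda>H. u H \<oplus>\<^bsub>M\<^esub> u' H"]) auto
next
  fix r y assume r: "r \<in> carrier R" and "y \<in> Red R M"
  then obtain F x where
    F: "finite F" "F \<subseteq> reduced_submodules R M" "\<forall>H\<in>F. x H \<in> H" "y = finsum M x F"
    by (auto simp: Red_def)
  have sub: "submodule H R M" if "H \<in> F" for H
    using that F by (auto simp: reduced_submodules_def)
  have "x \<in> F \<rightarrow> carrier M" using F(3) sub submoduleE(1) by blast
  then have "r \<odot>\<^bsub>M\<^esub> y = finsum M (\<lambda>H. r \<odot>\<^bsub>M\<^esub> x H) F"
    using finsum_smult_ldistr r F by blast
  moreover have "r \<odot>\<^bsub>M\<^esub> x H \<in> H" if "H \<in> F" for H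
    using submoduleE(4)[OF sub[OF that]] r F(3) that by blast
  ultimately show "r \<odot>\<^bsub>M\<^esub> y \<in> Red R M"
    unfolding Red_def using F
    by (intro CollectI exI[of _ F] exI[of _ "\<lambda>H. r \<odot>\<^bsub>M\<^esub> x H"]) auto
qed

text \<open>A reduced submodule of \<open>M\<close> lies in \<open>Red R M\<close> and is a reduced
  submodule there too, because its own module structure does not depend on the ambient carrier.
  Minimality of \<open>Red R M\<close> then gives the nontrivial inclusion.\<close>

lemma (in module) semi_reduced_Red: "semi_reduced R (M\<lparr>carrier := Red R M\<rparr>)"
proof -
  let ?D = "M\<lparr>carrier := Red R M\<rparr>"
  interpret D: module R ?D
    using submodule.submodule_is_module[OF submodule_Red] module_axioms by blast
  have le: "Red R ?D \<subseteq> Red R M"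
    using D.submoduleE(1)[OF D.submodule_Red] by simp
  have "H \<subseteq> Red R ?D" if H: "H \<in> reduced_submodules R M" for H
  proof (rule D.reduced_submodule_le_Red)
    show "H \<in> reduced_submodules R ?D"
      using H submodule_in_submodule[OF submodule_Red reduced_submodule_le_Red[OF H]]
      unfolding reduced_submodules_def by simp
  qed
  moreover have "submodule (Red R ?D) R M"
    using D.submodule_Red submodule_in_submodule[OF submodule_Red le] by blast
  ultimately have "Red R M \<subseteq> Red R ?D"
    by (rule Red_le_submodule[rotated])
  then show ?thesis
    using le by (simp add: semi_reduced_def)
qed

section \<open>Partial homomorphisms\<close>

text \<open>
  A homomorphism from a submodule of \<open>N\<close> to \<open>K\<close> is represented by its graph, so that extension is
  inclusion. By additivity, single-valuedness reduces to the last condition.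
\<close>

definition hom_graph ::
  "('r, 'x) ring_scheme \<Rightarrow> ('r, 'a, 'y) module_scheme \<Rightarrow> ('r, 'b, 'z) module_scheme
    \<Rightarrow> ('a \<times> 'b) set \<Rightarrow> bool"
  where "hom_graph R N K G \<longleftrightarrow>
    G \<subseteq> carrier N \<times> carrier K \<and> (\<zero>\<^bsub>N\<^esub>, \<zero>\<^bsub>K\<^esub>) \<in> G \<and>
    (\<forall>x y x' y'. (x, y) \<in> G \<longrightarrow> (x', y') \<in> G \<longrightarrow> (x \<oplus>\<^bsub>N\<^esub> x', y \<oplus>\<^bsub>K\<^esub> y') \<in> G) \<and>
    (\<forall>r x y. r \<in> carrier R \<longrightarrow> (x, y) \<in> G \<longrightarrow> (r \<odot>\<^bsub>N\<^esub> x, r \<odot>\<^bsub>K\<^esub> y) \<in> G) \<and>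
    (\<forall>y. (\<zero>\<^bsub>N\<^esub>, y) \<in> G \<longrightarrow> y = \<zero>\<^bsub>K\<^esub>)"

lemma hom_graphD:
  assumes "hom_graph R N K G"
  shows "(x, y) \<in> G \<Longrightarrow> x \<in> carrier N" "(x, y) \<in> G \<Longrightarrow> y \<in> carrier K"
    and "(\<zero>\<^bsub>N\<^esub>, \<zero>\<^bsub>K\<^esub>) \<in> G"
    and "(x, y) \<in> G \<Longrightarrow> (x', y') \<in> G \<Longrightarrow> (x \<oplus>\<^bsub>N\<^esub> x', y \<oplus>\<^bsub>K\<^esub> y') \<in> G"
    and "r \<in> carrier R \<Longrightarrow> (x, y) \<in> G \<Longrightarrow> (r \<odot>\<^bsub>N\<^esub> x, r \<odot>\<^bsub>K\<^esub> y) \<in> G"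
    and "(\<zero>\<^bsub>N\<^esub>, y) \<in> G \<Longrightarrow> y = \<zero>\<^bsub>K\<^esub>"
  using assms unfolding hom_graph_def by auto

locale two_modules = N: module R N + K: module R K
  for R :: "('r, 'x) ring_scheme" (structure)
    and N :: "('r, 'n, 'y) module_scheme" and K :: "('r, 'k, 'z) module_scheme"
begin

text \<open>Subtracting the two pairs, with -1 as a scalar, gives (0, y - y') in \<open>G\<close>,
  and the last condition of \<open>hom_graph\<close> applies.\<close>

lemma hom_graph_unique:
  assumes G: "hom_graph R N K G" and "(x, y) \<in> G" "(x, y') \<in> G"
  shows "y = y'"
proof -
  have c: "x \<in> carrier N" "y \<in> carrier K" "y' \<in> carrier K"
    using hom_graphD(1,2)[OF G] assms(2,3) by auto
  have "((\<ominus>\<^bsub>R\<^esub> \<one>\<^bsub>R\<^esub>) \<odot>\<^bsub>N\<^esub> x, (\<ominus>\<^bsub>R\<^esub> \<one>\<^bsub>R\<^esub>) \<odot>\<^bsub>K\<^esub> y') \<in> G"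
    using assms(3) by (intro hom_graphD(5)[OF G]) auto
  then have "(\<ominus>\<^bsub>N\<^esub> x, \<ominus>\<^bsub>K\<^esub> y') \<in> G"
    using c by (simp add: N.smult_l_minus K.smult_l_minus)
  then have "(x \<oplus>\<^bsub>N\<^esub> \<ominus>\<^bsub>N\<^esub> x, y \<oplus>\<^bsub>K\<^esub> \<ominus>\<^bsub>K\<^esub> y') \<in> G"
    by (rule hom_graphD(4)[OF G assms(2)])
  then have "y \<oplus>\<^bsub>K\<^esub> \<ominus>\<^bsub>K\<^esub> y' = \<zero>\<^bsub>K\<^esub>"
    using hom_graphD(6)[OF G] c by (simp add: N.M.r_neg)
  then show ?thesis
    using c by (metis K.M.minus_minus K.M.minus_equality K.M.a_inv_closed)
qed

lemma rmodule_homD: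
  assumes "submodule L R N" "f \<in> rmodule_hom R (N\<lparr>carrier := L\<rparr>) K"
  shows "x \<in> L \<Longrightarrow> f x \<in> carrier K"
    and "x \<in> L \<Longrightarrow> y \<in> L \<Longrightarrow> f (x \<oplus>\<^bsub>N\<^esub> y) = f x \<oplus>\<^bsub>K\<^esub> f y"
    and "r \<in> carrier R \<Longrightarrow> x \<in> L \<Longrightarrow> f (r \<odot>\<^bsub>N\<^esub> x) = r \<odot>\<^bsub>K\<^esub> f x"
    and "f \<zero>\<^bsub>N\<^esub> = \<zero>\<^bsub>K\<^esub>"
proof -
  show smult: "r \<in> carrier R \<Longrightarrow> x \<in> L \<Longrightarrow> f (r \<odot>\<^bsub>N\<^esub> x) = r \<odot>\<^bsub>K\<^esub> f x"
    and closed: "x \<in> L \<Longrightarrow> f x \<in> carrier K"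
    and "x \<in> L \<Longrightarrow> y \<in> L \<Longrightarrow> f (x \<oplus>\<^bsub>N\<^esub> y) = f x \<oplus>\<^bsub>K\<^esub> f y" for r x y
    using assms by (auto simp: rmodule_hom_def hom_def)
  show "f \<zero>\<^bsub>N\<^esub> = \<zero>\<^bsub>K\<^esub>"
    \<comment> \<open>Homogeneity for the scalar 0 yields f 0 = 0.\<close>
    using smult[of "\<zero>\<^bsub>R\<^esub>" "\<zero>\<^bsub>N\<^esub>"] closed[of "\<zero>\<^bsub>N\<^esub>"] N.submodule_zero[OF assms(1)] by simp
qed

lemmas rmodule_homD_total = rmodule_homD[OF N.carrier_is_submodule, simplified]

lemma hom_graph_of_hom:
  assumes L: "submodule L R N" and f: "f \<in> rmodule_hom R (N\<lparr>carrier := L\<rparr>) K"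
  shows "hom_graph R N K {(x, f x) | x. x \<in> L}"
  unfolding hom_graph_def
proof (intro conjI allI impI)
  show "{(x, f x) | x. x \<in> L} \<subseteq> carrier N \<times> carrier K"
    using N.submoduleE(1)[OF L] rmodule_homD(1)[OF L f] by blast
qed (use N.submodule_zero[OF L] N.submoduleE(4,5)[OF L] rmodule_homD(2,3,4)[OF L f] in simp_all)

lemma submodule_Domain:
  assumes "hom_graph R N K G"
  shows "submodule (Domain G) R N"
proof (rule N.submoduleI')
  show "\<zero>\<^bsub>N\<^esub> \<in> Domain G" using hom_graphD(3)[OF assms] by (rule DomainI)
qed (auto intro: hom_graphD[OF assms])

text \<open>Values of \<open>f\<close> are chosen from \<open>G\<close>. By uniqueness any pair
  shown to lie in \<open>G\<close> determines a value of \<open>f\<close>, so linearity is read off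
  from the closure conditions.\<close>

lemma hom_of_hom_graph:
  assumes G: "hom_graph R N K G"
  obtains f where "f \<in> rmodule_hom R (N\<lparr>carrier := Domain G\<rparr>) K"
    and "\<forall>x y. (x, y) \<in> G \<longleftrightarrow> x \<in> Domain G \<and> y = f x"
proof -
  have "\<forall>x\<in>Domain G. \<exists>y. (x, y) \<in> G" by blast
  then obtain f where f: "\<forall>x\<in>Domain G. (x, f x) \<in> G"
    unfolding bchoice_iff by blast
  have iff: "(x, y) \<in> G \<longleftrightarrow> x \<in> Domain G \<and> y = f x" for x y
    using f hom_graph_unique[OF G] by blast
  have "f x \<in> carrier K" if "x \<in> Domain G" for x
    using hom_graphD(2)[OF G] f that by blast
  moreover have "f (x \<oplus>\<^bsub>N\<^esub> y) = f x \<oplus>\<^bsub>K\<^esub> f y" if "x \<in> Domain G" "y \<in> Domain G" for x y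
  proof -
    have "(x \<oplus>\<^bsub>N\<^esub> y, f x \<oplus>\<^bsub>K\<^esub> f y) \<in> G"
      using that f by (intro hom_graphD(4)[OF G]) auto
    then show ?thesis using iff by simp
  qed
  moreover have "f (r \<odot>\<^bsub>N\<^esub> x) = r \<odot>\<^bsub>K\<^esub> f x" if "r \<in> carrier R" "x \<in> Domain G" for r x
  proof -
    have "(r \<odot>\<^bsub>N\<^esub> x, r \<odot>\<^bsub>K\<^esub> f x) \<in> G"
      using that f by (intro hom_graphD(5)[OF G]) auto
    then show ?thesis using iff by simp
  qed
  ultimately have "f \<in> rmodule_hom R (N\<lparr>carrier := Domain G\<rparr>) K"
    by (simp add: rmodule_hom_def hom_def Pi_iff)
  then show ?thesis using that[of f] iff by simp
qed

section \<open>Enlarging the domain of a graph\<close>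

text \<open>The new map sends x + r n to y + r k. The assumption \<open>compat\<close> is what makes
  this well defined where R n meets the domain of \<open>G\<close>.\<close>

lemma hom_graph_extend:
  assumes G: "hom_graph R N K G" and n: "n \<in> carrier N" and k: "k \<in> carrier K"
    and compat: "\<And>r y. r \<in> carrier R \<Longrightarrow> (r \<odot>\<^bsub>N\<^esub> n, y) \<in> G \<Longrightarrow> y = r \<odot>\<^bsub>K\<^esub> k"
  shows "\<exists>G'. hom_graph R N K G' \<and> G \<subseteq> G' \<and> n \<in> Domain G'"
proof -
  define G' where
    "G' = {(x \<oplus>\<^bsub>N\<^esub> r \<odot>\<^bsub>N\<^esub> n, y \<oplus>\<^bsub>K\<^esub> r \<odot>\<^bsub>K\<^esub> k) | x y r. (x, y) \<in> G \<and> r \<in> carrier R}"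
  have G'I: "(u, v) \<in> G'"
    if "(x, y) \<in> G" "r \<in> carrier R" "u = x \<oplus>\<^bsub>N\<^esub> r \<odot>\<^bsub>N\<^esub> n" "v = y \<oplus>\<^bsub>K\<^esub> r \<odot>\<^bsub>K\<^esub> k" for u v x y r
    using that unfolding G'_def by blast
  note GD = hom_graphD(1,2)[OF G] and zero = hom_graphD(3)[OF G]
    and add = hom_graphD(4)[OF G] and smult = hom_graphD(5)[OF G]
  have "G \<subseteq> G'"
  proof clarify
    fix x y assume "(x, y) \<in> G"
    then show "(x, y) \<in> G'"
      using GD n k by (intro G'I[of x y "\<zero>\<^bsub>R\<^esub>"]) auto
  qed
  moreover have "(n, k) \<in> G'"
    using zero n k by (intro G'I[of _ _ "\<one>\<^bsub>R\<^esub>"]) auto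
  moreover have "hom_graph R N K G'"
    unfolding hom_graph_def
  proof (intro conjI allI impI)
    show "G' \<subseteq> carrier N \<times> carrier K"
      using GD n k unfolding G'_def by auto
    show "(\<zero>\<^bsub>N\<^esub>, \<zero>\<^bsub>K\<^esub>) \<in> G'"
      using zero \<open>G \<subseteq> G'\<close> by blast
  next
    fix u v u' v' assume "(u, v) \<in> G'" "(u', v') \<in> G'"
    then obtain x y r x' y' r' where *: "(x, y) \<in> G" "r \<in> carrier R" "(x', y') \<in> G" "r' \<in> carrier R"
      "u = x \<oplus>\<^bsub>N\<^esub> r \<odot>\<^bsub>N\<^esub> n" "v = y \<oplus>\<^bsub>K\<^esub> r \<odot>\<^bsub>K\<^esub> k"
      "u' = x' \<oplus>\<^bsub>N\<^esub> r' \<odot>\<^bsub>N\<^esub> n" "v' = y' \<oplus>\<^bsub>K\<^esub> r' \<odot>\<^bsub>K\<^esub> k"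
      unfolding G'_def by blast
    show "(u \<oplus>\<^bsub>N\<^esub> u', v \<oplus>\<^bsub>K\<^esub> v') \<in> G'"
      using * GD[OF *(1)] GD[OF *(3)] n k
      by (intro G'I[OF add[OF *(1) *(3)], of "r \<oplus>\<^bsub>R\<^esub> r'"])
        (auto simp: N.smult_l_distr K.smult_l_distr N.M.a_ac K.M.a_ac)
  next
    fix s u v assume s: "s \<in> carrier R" and "(u, v) \<in> G'"
    then obtain x y r where *: "(x, y) \<in> G" "r \<in> carrier R"
      "u = x \<oplus>\<^bsub>N\<^esub> r \<odot>\<^bsub>N\<^esub> n" "v = y \<oplus>\<^bsub>K\<^esub> r \<odot>\<^bsub>K\<^esub> k"
      unfolding G'_def by blast
    show "(s \<odot>\<^bsub>N\<^esub> u, s \<odot>\<^bsub>K\<^esub> v) \<in> G'"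
      using * s GD[OF *(1)] n k
      by (intro G'I[OF smult[OF s *(1)], of "s \<otimes>\<^bsub>R\<^esub> r"])
        (auto simp: N.smult_assoc1 K.smult_assoc1 N.smult_r_distr K.smult_r_distr)
  next
    fix v assume "(\<zero>\<^bsub>N\<^esub>, v) \<in> G'"
    then obtain x y r where *: "(x, y) \<in> G" "r \<in> carrier R"
      "\<zero>\<^bsub>N\<^esub> = x \<oplus>\<^bsub>N\<^esub> r \<odot>\<^bsub>N\<^esub> n" "v = y \<oplus>\<^bsub>K\<^esub> r \<odot>\<^bsub>K\<^esub> k"
      unfolding G'_def by blast
    \<comment> \<open>Here x = (-r) n lies in the domain of \<open>G\<close>, so
      \<open>compat\<close> for the scalar -r forces y = -(r k).\<close>
    have "x = \<ominus>\<^bsub>N\<^esub> (r \<odot>\<^bsub>N\<^esub> n)"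
      using * GD[OF *(1)] n N.M.minus_equality by auto
    then have "x = (\<ominus>\<^bsub>R\<^esub> r) \<odot>\<^bsub>N\<^esub> n"
      using * n by (simp add: N.smult_l_minus)
    then have "y = (\<ominus>\<^bsub>R\<^esub> r) \<odot>\<^bsub>K\<^esub> k"
      using compat[of "\<ominus>\<^bsub>R\<^esub> r" y] * by simp
    then show "v = \<zero>\<^bsub>K\<^esub>"
      using * k by (simp add: K.smult_l_minus K.M.l_neg)
  qed
  ultimately show ?thesis by blast
qed

text \<open>Zorn's lemma for inclusion. Each closure condition involves at most two pairs, and two
  pairs from the union of a chain already lie in one of its members.\<close>

lemma maximal_hom_graph:
  assumes "hom_graph R N K G0"
  obtains G where "hom_graph R N K G" "G0 \<subseteq> G"
    and "\<forall>G'. hom_graph R N K G' \<longrightarrow> G \<subseteq> G' \<longrightarrow> G' = G"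
proof -
  let ?A = "{G. hom_graph R N K G \<and> G0 \<subseteq> G}"
  have "\<exists>G\<in>?A. \<forall>X\<in>?A. G \<subseteq> X \<longrightarrow> X = G"
  proof (rule subset_Zorn_nonempty)
    show "?A \<noteq> {}" using assms by blast
  next
    fix C assume C: "C \<noteq> {}" "subset.chain ?A C"
    then have A: "G \<in> ?A" if "G \<in> C" for G
      using that by (auto simp: subset.chain_def)
    have dir: "G \<subseteq> G' \<or> G' \<subseteq> G" if "G \<in> C" "G' \<in> C" for G G'
      using C(2) that by (auto simp: subset_chain_def)
    have CG: "hom_graph R N K G" "G0 \<subseteq> G" if "G \<in> C" for G
      using A[OF that] by auto
    obtain G1 where G1: "G1 \<in> C" using C(1) by blast
    have "hom_graph R N K (\<Union>C)"
      unfolding hom_graph_def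
    proof (intro conjI allI impI)
      show "\<Union>C \<subseteq> carrier N \<times> carrier K"
        by (rule Union_least) (use CG(1) in \<open>simp add: hom_graph_def\<close>)
      show "(\<zero>\<^bsub>N\<^esub>, \<zero>\<^bsub>K\<^esub>) \<in> \<Union>C"
        using hom_graphD(3)[OF CG(1)[OF G1]] G1 by (rule UnionI[rotated])
    next
      fix x y x' y' assume "(x, y) \<in> \<Union>C" "(x', y') \<in> \<Union>C"
      then obtain G1 G2 where G: "G1 \<in> C" "(x, y) \<in> G1" "G2 \<in> C" "(x', y') \<in> G2"
        by auto
      obtain G where "G \<in> C" "(x, y) \<in> G" "(x', y') \<in> G"
        using dir[OF G(1,3)] G by auto
      then show "(x \<oplus>\<^bsub>N\<^esub> x', y \<oplus>\<^bsub>K\<^esub> y') \<in> \<Union>C"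
        by (intro UnionI hom_graphD(4)[OF CG(1)])
    next
      fix r x y assume "r \<in> carrier R" "(x, y) \<in> \<Union>C"
      then show "(r \<odot>\<^bsub>N\<^esub> x, r \<odot>\<^bsub>K\<^esub> y) \<in> \<Union>C"
        by (elim UnionE, intro UnionI hom_graphD(5)[OF CG(1)])
    next
      fix y assume "(\<zero>\<^bsub>N\<^esub>, y) \<in> \<Union>C"
      then show "y = \<zero>\<^bsub>K\<^esub>"
        by (elim UnionE, intro hom_graphD(6)[OF CG(1)])
    qed
    moreover have "G0 \<subseteq> \<Union>C" using CG(2)[OF G1] G1 by (rule order_trans[OF _ Union_upper])
    ultimately show "\<Union>C \<in> ?A" by simp
  qed
  then obtain G where G: "G \<in> ?A" and max: "\<forall>X\<in>?A. G \<subseteq> X \<longrightarrow> X = G" ..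
  show ?thesis
  proof (rule that[of G])
    show "\<forall>G'. hom_graph R N K G' \<longrightarrow> G \<subseteq> G' \<longrightarrow> G' = G"
      using max G by auto
  qed (use G in auto)
qed

section \<open>Extending homomorphisms on lifting modules\<close>

lemma rmodule_hom_restrict:
  assumes "f \<in> rmodule_hom R (N\<lparr>carrier := L\<rparr>) K" "H \<subseteq> L"
  shows "f \<in> rmodule_hom R (N\<lparr>carrier := H\<rparr>) K"
  using assms by (auto simp: rmodule_hom_def hom_def subset_eq)

text \<open>Reducedness, unlike semi-reducedness, passes to the submodule
  \<open>L \<inter> H\<close>, so \<open>inj\<close> applies to \<open>f\<close> there. Since
  \<open>H\<close> contains all multiples of \<open>n\<close>, the extension \<open>g\<close> gives
  f (r n) = g (r n) = r (g n) whenever r n lies in \<open>L\<close>.\<close>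

lemma reduced_hom_compat:
  assumes inj: "Red_rel_injective R K N"
    and L: "submodule L R N" and f: "f \<in> rmodule_hom R (N\<lparr>carrier := L\<rparr>) K"
    and H: "H \<in> reduced_submodules R N" and n: "n \<in> H"
  shows "\<exists>k\<in>carrier K. \<forall>r\<in>carrier R. r \<odot>\<^bsub>N\<^esub> n \<in> L \<longrightarrow> f (r \<odot>\<^bsub>N\<^esub> n) = r \<odot>\<^bsub>K\<^esub> k"
proof -
  have HS: "submodule H R N" and Hred: "reduced_module R (N\<lparr>carrier := H\<rparr>)"
    using H by (auto simp: reduced_submodules_def)
  let ?X = "L \<inter> H"
  have X: "submodule ?X R N" using N.submodule_Int[OF L HS] .
  have "semi_reduced R (N\<lparr>carrier := ?X\<rparr>)"
    using module.reduced_imp_semi_reduced[OF submodule.submodule_is_module[OF X N.module_axioms]]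
      reduced_submodule_mono[OF Hred] by blast
  moreover have "f \<in> rmodule_hom R (N\<lparr>carrier := ?X\<rparr>) K"
    using rmodule_hom_restrict[OF f] by blast
  ultimately obtain g where g: "g \<in> rmodule_hom R N K" "\<forall>x\<in>?X. g x = f x"
    using inj X unfolding Red_rel_injective_def by blast
  have nN: "n \<in> carrier N" using n N.submoduleE(1)[OF HS] by blast
  have "f (r \<odot>\<^bsub>N\<^esub> n) = r \<odot>\<^bsub>K\<^esub> g n" if "r \<in> carrier R" "r \<odot>\<^bsub>N\<^esub> n \<in> L" for r
    using that g(2) N.submoduleE(4)[OF HS that(1) n] rmodule_homD_total(3)[OF g(1) that(1) nN]
    by auto
  then show ?thesis using rmodule_homD_total(1)[OF g(1) nN] by blast
qed

lemma lifting_hom_compat: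
  assumes lift: "Red_lifting R N"
    and L: "submodule L R N" and f: "f \<in> rmodule_hom R (N\<lparr>carrier := L\<rparr>) K"
    and RedL: "Red R N \<subseteq> L"
    and h: "h \<in> rmodule_hom R N K" and fh: "\<And>x. x \<in> Red R N \<Longrightarrow> h x = f x"
    and n: "n \<in> carrier N"
  shows "\<exists>k\<in>carrier K. \<forall>r\<in>carrier R. r \<odot>\<^bsub>N\<^esub> n \<in> L \<longrightarrow> f (r \<odot>\<^bsub>N\<^esub> n) = r \<odot>\<^bsub>K\<^esub> k"
proof -
  let ?C = "{r \<odot>\<^bsub>N\<^esub> n | r. r \<in> carrier R}"
  let ?X = "L \<inter> ?C"
  have "submodule ?X R N"
    using N.submodule_Int[OF L N.submodule_cyclic[OF n]] .
  then obtain A B A' where A: "submodule A R N" and A': "submodule A' R N"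
    and NA: "carrier N = A <+>\<^bsub>N\<^esub> A'" and AA': "A \<inter> A' = {\<zero>\<^bsub>N\<^esub>}"
    and B: "submodule B R N" "B \<subseteq> Red R N" and AX: "A \<subseteq> ?X" and XAB: "?X = A <+>\<^bsub>N\<^esub> B"
    using lift unfolding Red_lifting_def Red_respects_def direct_summand_def is_direct_sum_def by meson
  obtain a0 a0' where a0: "a0 \<in> A" "a0' \<in> A'" "n = a0 \<oplus>\<^bsub>N\<^esub> a0'"
    using n NA by (auto simp: set_add_def')
  \<comment> \<open>As \<open>A\<close> lies in R n, the component of \<open>n\<close> in
    \<open>A\<close> is a multiple of \<open>n\<close>. The scalar \<open>e\<close> then acts on R n
    as the projection onto \<open>A\<close> along \<open>A'\<close>.\<close>
  obtain e where e: "e \<in> carrier R" "a0 = e \<odot>\<^bsub>N\<^esub> n" using a0(1) AX by blast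
  note AN = N.submoduleE(1)[OF A] and A'N = N.submoduleE(1)[OF A'] and BN = N.submoduleE(1)[OF B(1)]
  have a0N: "a0 \<in> carrier N" "a0' \<in> carrier N" using a0 AN A'N by auto
  have a0L: "a0 \<in> L" using a0 AX by blast
  note fD = rmodule_homD[OF L f] and hD = rmodule_homD_total[OF h]
  have fa0: "f a0 \<in> carrier K" "h a0 \<in> carrier K" "h n \<in> carrier K"
    using fD(1)[OF a0L] hD(1) a0N n by auto
  \<comment> \<open>The value \<open>h n\<close> is corrected by the difference of \<open>f\<close>
    and \<open>h\<close> at the component of \<open>n\<close> in \<open>A\<close>.\<close>
  define k where "k = (f a0 \<oplus>\<^bsub>K\<^esub> \<ominus>\<^bsub>K\<^esub> h a0) \<oplus>\<^bsub>K\<^esub> h n"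
  have "f (r \<odot>\<^bsub>N\<^esub> n) = r \<odot>\<^bsub>K\<^esub> k" if r: "r \<in> carrier R" "r \<odot>\<^bsub>N\<^esub> n \<in> L" for r
  proof -
    have "r \<odot>\<^bsub>N\<^esub> n \<in> ?X" using r by blast
    then obtain a b where ab: "a \<in> A" "b \<in> B" "r \<odot>\<^bsub>N\<^esub> n = a \<oplus>\<^bsub>N\<^esub> b"
      unfolding XAB by (auto simp: set_add_def')
    obtain s where s: "s \<in> carrier R" "a = s \<odot>\<^bsub>N\<^esub> n" using ab(1) AX by blast
    have abN: "a \<in> carrier N" "b \<in> carrier N" using ab AN BN by auto
    have sa0: "s \<odot>\<^bsub>N\<^esub> a0 \<in> A" "s \<odot>\<^bsub>N\<^esub> a0' \<in> A'"
      using N.submoduleE(4)[OF A s(1) a0(1)] N.submoduleE(4)[OF A' s(1) a0(2)] by auto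
    have a_split: "a = s \<odot>\<^bsub>N\<^esub> a0 \<oplus>\<^bsub>N\<^esub> s \<odot>\<^bsub>N\<^esub> a0'"
      using s a0 a0N by (simp add: N.smult_r_distr)
    \<comment> \<open>Since a = s n already lies in \<open>A\<close>, its component s a0' in
      \<open>A'\<close> must vanish.\<close>
    then have "s \<odot>\<^bsub>N\<^esub> a0' = \<ominus>\<^bsub>N\<^esub> (s \<odot>\<^bsub>N\<^esub> a0) \<oplus>\<^bsub>N\<^esub> a"
      using s a0N by (simp add: N.M.r_neg1)
    then have "s \<odot>\<^bsub>N\<^esub> a0' \<in> A \<inter> A'"
      using N.submoduleE(5)[OF A N.submoduleE(3)[OF A sa0(1)] ab(1)] sa0(2) by simp
    then have "s \<odot>\<^bsub>N\<^esub> a0' = \<zero>\<^bsub>N\<^esub>" using AA' by blast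
    then have a: "a = s \<odot>\<^bsub>N\<^esub> a0" using a_split s a0N by simp
    \<comment> \<open>Commutativity of the ring enters here: e (s n) = s (e n) = s a0 = a.\<close>
    have ea: "e \<odot>\<^bsub>N\<^esub> a = a"
    proof -
      have "e \<odot>\<^bsub>N\<^esub> a = (e \<otimes>\<^bsub>R\<^esub> s) \<odot>\<^bsub>N\<^esub> n"
        using s e n by (simp add: N.smult_assoc1)
      also have "\<dots> = (s \<otimes>\<^bsub>R\<^esub> e) \<odot>\<^bsub>N\<^esub> n" using s e by (simp add: N.R.m_comm)
      also have "\<dots> = a" using s e n a by (simp add: N.smult_assoc1)
      finally show ?thesis .
    qed
    \<comment> \<open>The complements \<open>B\<close> and \<open>A'\<close> may differ, so r a0
      need not equal a. It is e (r n) = a + e b, and the extra term e b stays in \<open>B\<close>,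
      where \<open>f\<close> and \<open>h\<close> agree.\<close>
    have "r \<odot>\<^bsub>N\<^esub> a0 = (r \<otimes>\<^bsub>R\<^esub> e) \<odot>\<^bsub>N\<^esub> n"
      using r e n by (simp add: N.smult_assoc1)
    also have "\<dots> = (e \<otimes>\<^bsub>R\<^esub> r) \<odot>\<^bsub>N\<^esub> n" using r e by (simp add: N.R.m_comm)
    also have "\<dots> = e \<odot>\<^bsub>N\<^esub> (a \<oplus>\<^bsub>N\<^esub> b)" using r e n ab(3) by (simp add: N.smult_assoc1)
    finally have ra0: "r \<odot>\<^bsub>N\<^esub> a0 = a \<oplus>\<^bsub>N\<^esub> e \<odot>\<^bsub>N\<^esub> b"
      using e abN ea by (simp add: N.smult_r_distr)
    have eb: "e \<odot>\<^bsub>N\<^esub> b \<in> B" using N.submoduleE(4)[OF B(1) e(1) ab(2)] .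
    have inL: "a \<in> L" "b \<in> L" "e \<odot>\<^bsub>N\<^esub> b \<in> L" using ab eb AX B(2) RedL by auto
    have hb: "h b = f b" "h (e \<odot>\<^bsub>N\<^esub> b) = f (e \<odot>\<^bsub>N\<^esub> b)" using fh ab(2) eb B(2) by auto
    have c: "f a \<in> carrier K" "f b \<in> carrier K" "f (e \<odot>\<^bsub>N\<^esub> b) \<in> carrier K" "h a \<in> carrier K"
      using fD(1) inL hD(1) abN by auto
    have "r \<odot>\<^bsub>K\<^esub> f a0 = f a \<oplus>\<^bsub>K\<^esub> f (e \<odot>\<^bsub>N\<^esub> b)"
      using fD(3)[OF r(1) a0L] fD(2)[OF inL(1,3)] ra0 by simp
    moreover have "r \<odot>\<^bsub>K\<^esub> h a0 = h a \<oplus>\<^bsub>K\<^esub> f (e \<odot>\<^bsub>N\<^esub> b)"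
      using hD(3)[OF r(1) a0N(1)] hD(2)[of a "e \<odot>\<^bsub>N\<^esub> b"] ra0 abN e hb by simp
    moreover have "r \<odot>\<^bsub>K\<^esub> h n = h a \<oplus>\<^bsub>K\<^esub> f b"
      using hD(3)[OF r(1) n] hD(2)[OF abN] ab(3) hb by simp
    ultimately have "r \<odot>\<^bsub>K\<^esub> k =
      (f a \<oplus>\<^bsub>K\<^esub> f (e \<odot>\<^bsub>N\<^esub> b)) \<oplus>\<^bsub>K\<^esub> \<ominus>\<^bsub>K\<^esub> (h a \<oplus>\<^bsub>K\<^esub> f (e \<odot>\<^bsub>N\<^esub> b)) \<oplus>\<^bsub>K\<^esub> (h a \<oplus>\<^bsub>K\<^esub> f b)"
      unfolding k_def using r fa0 by (simp add: K.smult_r_distr K.smult_r_minus)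
    \<comment> \<open>Both f (e b) and h a cancel.\<close>
    also have "\<dots> = f a \<oplus>\<^bsub>K\<^esub> f b"
      using c by (simp add: K.M.minus_add K.M.a_ac K.M.r_neg K.M.r_neg1 K.M.r_neg2)
    also have "\<dots> = f (r \<odot>\<^bsub>N\<^esub> n)" using fD(2)[OF inL(1,2)] ab(3) by simp
    finally show ?thesis by simp
  qed
  moreover have "k \<in> carrier K" using fa0 unfolding k_def by simp
  ultimately show ?thesis by blast
qed

lemma Red_rel_injective_imp_rel_injective:
  assumes lift: "Red_lifting R N" and inj: "Red_rel_injective R K N"
  shows "rel_injective R K N"
  unfolding rel_injective_def
proof (intro allI impI, elim conjE)
  fix L0 f0 assume L0: "submodule L0 R N" and f0: "f0 \<in> rmodule_hom R (N\<lparr>carrier := L0\<rparr>) K"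
  obtain G where G: "hom_graph R N K G" and ext: "{(x, f0 x) | x. x \<in> L0} \<subseteq> G"
    and max: "\<forall>G'. hom_graph R N K G' \<longrightarrow> G \<subseteq> G' \<longrightarrow> G' = G"
    by (rule maximal_hom_graph[OF hom_graph_of_hom[OF L0 f0]])
  obtain f where f: "f \<in> rmodule_hom R (N\<lparr>carrier := Domain G\<rparr>) K"
    and Gf: "\<forall>x y. (x, y) \<in> G \<longleftrightarrow> x \<in> Domain G \<and> y = f x"
    by (rule hom_of_hom_graph[OF G])
  note L = submodule_Domain[OF G]
  \<comment> \<open>A compatible \<open>k\<close> would allow an extension of \<open>G\<close> to
    \<open>n\<close>, which by maximality is \<open>G\<close> itself.\<close>
  have step: "n \<in> Domain G" if n: "n \<in> carrier N"
    and k: "\<exists>k\<in>carrier K. \<forall>r\<in>carrier R. r \<odot>\<^bsub>N\<^esub> n \<in> Domain G \<longrightarrow> f (r \<odot>\<^bsub>N\<^esub> n) = r \<odot>\<^bsub>K\<^esub> k" for n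
  proof -
    obtain k where kK: "k \<in> carrier K"
      and k: "\<forall>r\<in>carrier R. r \<odot>\<^bsub>N\<^esub> n \<in> Domain G \<longrightarrow> f (r \<odot>\<^bsub>N\<^esub> n) = r \<odot>\<^bsub>K\<^esub> k"
      using k by blast
    have "y = r \<odot>\<^bsub>K\<^esub> k" if "r \<in> carrier R" "(r \<odot>\<^bsub>N\<^esub> n, y) \<in> G" for r y
      using k that Gf by simp
    then obtain G' where "hom_graph R N K G'" "G \<subseteq> G'" "n \<in> Domain G'"
      using hom_graph_extend[OF G n kK] by blast
    then show ?thesis using max by blast
  qed
  have RedL: "Red R N \<subseteq> Domain G"
  proof (rule N.Red_le_submodule[OF L], rule subsetI)
    fix H n assume H: "H \<in> reduced_submodules R N" and n: "n \<in> H"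
    then have "n \<in> carrier N"
      using N.submoduleE(1) by (auto simp: reduced_submodules_def)
    then show "n \<in> Domain G" using reduced_hom_compat[OF inj L f H n] by (rule step)
  qed
  \<comment> \<open>Only now is \<open>f\<close> defined on all of the semi-reduced submodule
    \<open>Red R N\<close>, so that \<open>inj\<close> can be applied to its restriction.\<close>
  obtain h where h: "h \<in> rmodule_hom R N K" "\<forall>x\<in>Red R N. h x = f x"
    using inj N.submodule_Red N.semi_reduced_Red rmodule_hom_restrict[OF f RedL]
    unfolding Red_rel_injective_def by blast
  have "carrier N \<subseteq> Domain G"
  proof
    fix n assume n: "n \<in> carrier N"
    show "n \<in> Domain G"
      using lifting_hom_compat[OF lift L f RedL h(1) _ n] h(2) by (intro step[OF n]) blast
  qed
  then have "Domain G = carrier N" using N.submoduleE(1)[OF L] by blast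
  then have "f \<in> rmodule_hom R N K" using f by simp
  moreover have "f x = f0 x" if "x \<in> L0" for x
  proof -
    have "(x, f0 x) \<in> G" using ext that by blast
    then show ?thesis using Gf by simp
  qed
  ultimately show "\<exists>g\<in>rmodule_hom R N K. \<forall>x\<in>L0. g x = f0 x" by blast
qed

end

theorem proposition9:
  fixes R :: "('r, 'x) ring_scheme"
    and N :: "('r, 'n, 'y) module_scheme"
    and K :: "('r, 'k, 'z) module_scheme"
  assumes "module R N"
    and "Red_lifting R N"
    and "module R K"
  shows "Red_rel_injective R K N \<longleftrightarrow> rel_injective R K N"
proof
  assume "Red_rel_injective R K N"
  then show "rel_injective R K N"
    using two_modules.Red_rel_injective_imp_rel_injective[OF two_modules.intro] assms by blast
next
  assume "rel_injective R K N"
  then show "Red_rel_injective R K N"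
    unfolding rel_injective_def Red_rel_injective_def by blast
qed

end
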